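(* Let $\beta,\gamma\ge0$ and let $X_1,\dots,X_n$ be i.i.d. from $f_{\boldsymbol\theta}$, where $f_{\boldsymbol\theta}$ belongs to the parametric model described in the context and conditions (LB1)–(LB5) of the context are satisfied. Assume that $\boldsymbol\theta\notin\Theta_0$ is the true value of the parameter, with $\widehat{\boldsymbol\theta}_\beta\to\boldsymbol\theta$ in probability as $n\to\infty$ under $H_1:\boldsymbol\theta\notin\Theta_0$. Suppose there exists $\boldsymbol\theta^*\in\Theta_0$ such that the restricted minimum density power divergence estimator satisfies $\widetilde{\boldsymbol\theta}_\beta\to\boldsymbol\theta^*$ in probability as $n\to\infty$. Further assume that $$n^{1/2}\begin{pmatrix}\widehat{\boldsymbol\theta}_\beta-\boldsymbol\theta\\ \widetilde{\boldsymbol\theta}_\beta-\boldsymbol\theta^*\end{pmatrix}\xrightarrow[n\to\infty]{\mathcal L}\mathcal N\left(\begin{pmatrix}\boldsymbol0_p\\\boldsymbol0_p\end{pmatrix},\begin{pmatrix}\boldsymbol J_\beta^{-1}(\boldsymbol\theta)\boldsymbol K_\beta(\boldsymbol\theta)\boldsymbol J_\beta^{-1}(\boldsymbol\theta)&\boldsymbol A_{12}(\boldsymbol\theta,\boldsymbol\theta^* )\\ \boldsymbol A_{12}(\boldsymbol\theta,\boldsymbol\theta^* )^T&\boldsymbol\Sigma(\boldsymbol\theta,\boldsymbol\theta^* )\end{pmatrix}\right),$$ where $\boldsymbol A_{12}(\boldsymbol\theta,\boldsymbol\theta^* )$ and $\boldsymbol\Sigma(\boldsymbol\theta,\boldsymbol\theta^*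 )$ are appropriate $p\times p$ matrices. Then, under $H_1$, $$n^{1/2}\left(d_\gamma(f_{\widehat{\boldsymbol\theta}_\beta},f_{\widetilde{\boldsymbol\theta}_\beta})-d_\gamma(f_{\boldsymbol\theta},f_{\boldsymbol\theta^*})\right)\xrightarrow[n\to\infty]{\mathcal L}\mathcal N\left(0,\sigma_{\beta,\gamma}^2(\boldsymbol\theta,\boldsymbol\theta^* )\right),$$ where $$\sigma_{\beta,\gamma}^2(\boldsymbol\theta,\boldsymbol\theta^* )=\boldsymbol t^T\boldsymbol J_\beta^{-1}(\boldsymbol\theta)\boldsymbol K_\beta(\boldsymbol\theta)\boldsymbol J_\beta^{-1}(\boldsymbol\theta)\boldsymbol t+2\boldsymbol t^T\boldsymbol A_{12}(\boldsymbol\theta,\boldsymbol\theta^* )\boldsymbol s+\boldsymbol s^T\boldsymbol\Sigma(\boldsymbol\theta,\boldsymbol\theta^* )\boldsymbol s$$ and $$\boldsymbol t=\left(\frac{\partial d_\gamma(f_{\boldsymbol\theta_1},f_{\boldsymbol\theta^*})}{\partial\boldsymbol\theta_1}\right)_{\boldsymbol\theta_1=\boldsymbol\theta},\qquad\boldsymbol s=\left(\frac{\partial d_\gamma(f_{\boldsymbol\theta},f_{\boldsymbol\theta_2})}{\partial\boldsymbol\theta_2}\right)_{\boldsymbol\theta_2=\boldsymbol\theta^*}.$$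
   Context: Model. $\{P_{\boldsymbol\theta}:\boldsymbol\theta\in\Theta\}$ is an identifiable parametric family of probability measures on a measurable space $\mathcal X$, $\Theta\subset\mathbb R^p$ open, $p\ge1$, with densities $f_{\boldsymbol\theta}$ with respect to a $\sigma$-finite measure $\mu$; $\int\cdots dx$ denotes integration with respect to $\mu$. The support does not depend on $\boldsymbol\theta$. Constraints. $\boldsymbol g:\mathbb R^p\to\mathbb R^r$, $r<p$, is such that the $p\times r$ matrix $\boldsymbol G(\boldsymbol\theta)=\partial\boldsymbol g^T(\boldsymbol\theta)/\partial\boldsymbol\theta$ exists, is continuous in $\boldsymbol\theta$, and has rank $r$. $\Theta_0=\{\boldsymbol\theta\in\Theta:\boldsymbol g(\boldsymbol\theta)=\boldsymbol 0_r\}$. Density power divergence between densities $h,f$: for $\gamma>0$, $d_\gamma(h,f)=\int\{f^{1+\gamma}(x)-(1+\frac1\gamma)f^\gamma(x)h(x)+\frac1\gamma h^{1+\gamma}(x)\}dx$; for $\gamma=0$, $d_0(h,f)=\int h(x)\log\frac{h(x)}{f(x)}dx$. Notation. $\boldsymbol u_{\boldsymbol\theta}(x)=\frac{\partial}{\partial\boldsymbol\theta}\log f_{\boldsymbol\theta}(x)$, $\boldsymbol I_{\boldsymbol\theta}(x)=-\frac{\partial}{\partial\boldsymbol\theta}\boldsymbol u_{\boldsymbol\theta}(x)$. For $\beta>0$, $V_{\boldsymbol\theta}(x)=\int f_{\boldsymbol\theta}^{1+\beta}(y)dy-(1+\frac1\beta)f_{\boldsymbol\theta}^\beta(x)$;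 for $\beta=0$, $V_{\boldsymbol\theta}(x)=-\log f_{\boldsymbol\theta}(x)$. When the true density belongs to the model, the following matrices (assumed to exist) are used: $$\boldsymbol J_\beta(\boldsymbol\theta)=\int\boldsymbol u_{\boldsymbol\theta}\boldsymbol u_{\boldsymbol\theta}^Tf_{\boldsymbol\theta}^{1+\beta}dx,\quad \boldsymbol K_\beta(\boldsymbol\theta)=\int\boldsymbol u_{\boldsymbol\theta}\boldsymbol u_{\boldsymbol\theta}^Tf_{\boldsymbol\theta}^{1+2\beta}dx-\boldsymbol\xi_\beta(\boldsymbol\theta)\boldsymbol\xi_\beta(\boldsymbol\theta)^T,\quad \boldsymbol\xi_\beta(\boldsymbol\theta)=\int\boldsymbol u_{\boldsymbol\theta}f_{\boldsymbol\theta}^{1+\beta}dx.$$ Estimators. The minimum density power divergence estimator $\widehat{\boldsymbol\theta}_\beta$ minimizes $\frac1n\sum_{i=1}^nV_{\boldsymbol\theta}(X_i)$ over $\Theta$ (it denotes a consistent sequence of roots of the corresponding estimating equation); the restricted minimum density power divergence estimator $\widetilde{\boldsymbol\theta}_\beta$ minimizes the same objective subject to $\boldsymbol g(\boldsymbol\theta)=\boldsymbol0_r$. Conditions (for true density $h$, here the model density at the true parameter): (LB1) The model distributions have common support, so $\mathcal X=\{x: f_{\boldsymbol\theta}(x)>0\}$ is independent of $\boldsymbol\theta$; the true distribution is also supported on $\mathcal X$, on which $h>0$. (LB2) There is an open subset $\omega\subset\Theta$ containing the best fitting parameter (here the true parameter) such that for almost all $x\in\mathcal X$ and all $\boldsymbol\theta\in\omega$,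 $f_{\boldsymbol\theta}(x)$ is three times differentiable in $\boldsymbol\theta$ with third partial derivatives continuous in $\boldsymbol\theta$. (LB3) $\int f_{\boldsymbol\theta}^{1+\beta}(x)dx$ and $\int f_{\boldsymbol\theta}^\beta(x)h(x)dx$ can be differentiated three times with respect to $\boldsymbol\theta$, and the derivatives can be taken under the integral sign. (LB4) The $p\times p$ matrix $\int\boldsymbol u_{\boldsymbol\theta}\boldsymbol u_{\boldsymbol\theta}^Tf_{\boldsymbol\theta}^{1+\beta}dx+\int\{\boldsymbol I_{\boldsymbol\theta}-\beta\boldsymbol u_{\boldsymbol\theta}\boldsymbol u_{\boldsymbol\theta}^T\}\{h-f_{\boldsymbol\theta}\}f_{\boldsymbol\theta}^\beta dx$ is positive definite at the best fitting parameter (where here it equals $\boldsymbol J_\beta$). (LB5) There exist functions $M_{jkl}$ with $|\nabla_{jkl}V_{\boldsymbol\theta}(x)|\le M_{jkl}(x)$ for all $\boldsymbol\theta\in\omega$ (third-order partial derivatives in $\boldsymbol\theta$) and $E_h[M_{jkl}(X)]<\infty$ for all $j,k,l$.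
   Formalization: The formal theorem additionally assumes that d_γ(f_θ1, f_θ2) is jointly (Fréchet) differentiable in (θ1, θ2) at (θ, θ* ), as existence of t and s alone does not suffice, and that the divergence evaluated at the two estimators is measurable. *)

theory Defs
  imports "HOL-Probability.Probability"
begin

section \<open>Partial derivatives\<close>

definition pd :: "'p::finite \<Rightarrow> (real^'p \<Rightarrow> real) \<Rightarrow> real^'p \<Rightarrow> real" where
  "pd i F \<theta> = deriv (\<lambda>t. F (\<theta> + t *\<^sub>R axis i 1)) 0"

definition grad :: "(real^'p::finite \<Rightarrow> real) \<Rightarrow> real^'p \<Rightarrow> real^'p" where
  "grad F \<theta> = (\<chi> i. pd i F \<theta>)"

text \<open>\<open>pds [i, j, k] F\<close> is the partial derivative of order 3 of \<open>F\<close> with respect to the coordinates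
  \<open>k\<close>, \<open>j\<close>, \<open>i\<close> (in this order of differentiation).\<close>

definition pds :: "'p::finite list \<Rightarrow> (real^'p \<Rightarrow> real) \<Rightarrow> real^'p \<Rightarrow> real" where
  "pds is F = foldr pd is F"

text \<open>On an open set \<open>W\<close>: \<open>F\<close> and all its partial derivatives of order less than \<open>k\<close> are
  (Frechet) differentiable. Only used for open \<open>W\<close>.\<close>

definition times_differentiable_on :: "nat \<Rightarrow> (real^'p::finite \<Rightarrow> real) \<Rightarrow> (real^'p) set \<Rightarrow> bool" where
  "times_differentiable_on k F W \<longleftrightarrow> (\<forall>is. length is < k \<longrightarrow> pds is F differentiable_on W)"


section \<open>Densities, the model and the constraints\<close>

definition dens_support :: "'x measure \<Rightarrow> ('x \<Rightarrow> real) \<Rightarrow> 'x set" where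
  "dens_support \<mu> f = {x \<in> space \<mu>. 0 < f x}"

definition is_density :: "'x measure \<Rightarrow> ('x \<Rightarrow> real) \<Rightarrow> bool" where
  "is_density \<mu> f \<longleftrightarrow> f \<in> borel_measurable \<mu> \<and> (\<forall>x\<in>space \<mu>. 0 \<le> f x) \<and>
     prob_space (density \<mu> (\<lambda>x. ennreal (f x)))"

definition parametric_model :: "'x measure \<Rightarrow> (real^'p::finite) set \<Rightarrow> (real^'p \<Rightarrow> 'x \<Rightarrow> real) \<Rightarrow> bool" where
  "parametric_model \<mu> \<Theta> f \<longleftrightarrow>
     sigma_finite_measure \<mu> \<and> open \<Theta> \<and>
     (\<forall>\<theta>\<in>\<Theta>. is_density \<mu> (f \<theta>)) \<and>
     inj_on (\<lambda>\<theta>. density \<mu> (\<lambda>x. ennreal (f \<theta> x))) \<Theta> \<and>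
     (\<forall>\<theta>\<in>\<Theta>. \<forall>\<theta>'\<in>\<Theta>. dens_support \<mu> (f \<theta>) = dens_support \<mu> (f \<theta>'))"

text \<open>The \<open>p \<times> r\<close> matrix with entry \<open>(i, j)\<close> equal to the partial derivative of the \<open>j\<close>-th component
  of \<open>g\<close> with respect to the \<open>i\<close>-th coordinate; the library's \<open>jacobian\<close> is its transpose.\<close>

definition G_matrix :: "(real^'p::finite \<Rightarrow> real^'r::finite) \<Rightarrow> real^'p \<Rightarrow> real^'r^'p" where
  "G_matrix g \<theta> = transpose (jacobian g (at \<theta>))"

definition regular_constraints :: "(real^'p::finite) set \<Rightarrow> (real^'p \<Rightarrow> real^'r::finite) \<Rightarrow> bool" where
  "regular_constraints \<Theta> g \<longleftrightarrow>
     CARD('r) < CARD('p) \<and>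
     (\<forall>\<theta>\<in>\<Theta>. g differentiable (at \<theta>)) \<and>
     continuous_on \<Theta> (G_matrix g) \<and>
     (\<forall>\<theta>\<in>\<Theta>. rank (G_matrix g \<theta>) = CARD('r))"


section \<open>Density power divergence and the associated quantities\<close>

text \<open>\<open>h\<close> and \<open>f\<close> vanish together outside the common support; there all integrands below are \<open>0\<close>,
  since \<open>0 powr a = 0\<close> and the logarithms are multiplied by \<open>0\<close>.\<close>

definition dpd :: "'x measure \<Rightarrow> real \<Rightarrow> ('x \<Rightarrow> real) \<Rightarrow> ('x \<Rightarrow> real) \<Rightarrow> real" where
  "dpd \<mu> \<gamma> h f =
    (if \<gamma> = 0 then (\<integral>x. h x * ln (h x / f x) \<partial>\<mu>)
     else (\<integral>x. f x powr (1 + \<gamma>) - (1 + 1 / \<gamma>) * f x powr \<gamma> * h x + 1 / \<gamma> * h x powr (1 + \<gamma>) \<partial>\<mu>))"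

definition V :: "'x measure \<Rightarrow> real \<Rightarrow> (real^'p::finite \<Rightarrow> 'x \<Rightarrow> real) \<Rightarrow> real^'p \<Rightarrow> 'x \<Rightarrow> real" where
  "V \<mu> \<beta> f \<theta> x =
    (if \<beta> = 0 then - ln (f \<theta> x)
     else (\<integral>y. f \<theta> y powr (1 + \<beta>) \<partial>\<mu>) - (1 + 1 / \<beta>) * f \<theta> x powr \<beta>)"

definition score :: "(real^'p::finite \<Rightarrow> 'x \<Rightarrow> real) \<Rightarrow> real^'p \<Rightarrow> 'x \<Rightarrow> real^'p" where
  "score f \<theta> x = grad (\<lambda>\<theta>'. ln (f \<theta>' x)) \<theta>"

definition info :: "(real^'p::finite \<Rightarrow> 'x \<Rightarrow> real) \<Rightarrow> real^'p \<Rightarrow> 'x \<Rightarrow> real^'p^'p" where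
  "info f \<theta> x = (\<chi> i j. - pd i (\<lambda>\<theta>'. score f \<theta>' x $ j) \<theta>)"

definition J_matrix :: "'x measure \<Rightarrow> (real^'p::finite \<Rightarrow> 'x \<Rightarrow> real) \<Rightarrow> real \<Rightarrow> real^'p \<Rightarrow> real^'p^'p" where
  "J_matrix \<mu> f \<beta> \<theta> =
    (\<chi> i j. \<integral>x. score f \<theta> x $ i * score f \<theta> x $ j * f \<theta> x powr (1 + \<beta>) \<partial>\<mu>)"

definition xi_vector :: "'x measure \<Rightarrow> (real^'p::finite \<Rightarrow> 'x \<Rightarrow> real) \<Rightarrow> real \<Rightarrow> real^'p \<Rightarrow> real^'p" where
  "xi_vector \<mu> f \<beta> \<theta> = (\<chi> i. \<integral>x. score f \<theta> x $ i * f \<theta> x powr (1 + \<beta>) \<partial>\<mu>)"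

definition K_matrix :: "'x measure \<Rightarrow> (real^'p::finite \<Rightarrow> 'x \<Rightarrow> real) \<Rightarrow> real \<Rightarrow> real^'p \<Rightarrow> real^'p^'p" where
  "K_matrix \<mu> f \<beta> \<theta> =
    (\<chi> i j. (\<integral>x. score f \<theta> x $ i * score f \<theta> x $ j * f \<theta> x powr (1 + 2 * \<beta>) \<partial>\<mu>)
            - xi_vector \<mu> f \<beta> \<theta> $ i * xi_vector \<mu> f \<beta> \<theta> $ j)"

definition JK_exist :: "'x measure \<Rightarrow> (real^'p::finite \<Rightarrow> 'x \<Rightarrow> real) \<Rightarrow> real \<Rightarrow> real^'p \<Rightarrow> bool" where
  "JK_exist \<mu> f \<beta> \<theta> \<longleftrightarrow>
     (\<forall>i j. integrable \<mu> (\<lambda>x. score f \<theta> x $ i * score f \<theta> x $ j * f \<theta> x powr (1 + \<beta>))) \<and>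
     (\<forall>i j. integrable \<mu> (\<lambda>x. score f \<theta> x $ i * score f \<theta> x $ j * f \<theta> x powr (1 + 2 * \<beta>))) \<and>
     (\<forall>i. integrable \<mu> (\<lambda>x. score f \<theta> x $ i * f \<theta> x powr (1 + \<beta>)))"


section \<open>Regularity conditions of Lehmann and Basu et al.\<close>

text \<open>\<open>h\<close> is the true density, \<open>\<theta>\<close> the best fitting parameter and \<open>W\<close> the neighbourhood of \<open>\<theta>\<close>
  shared by the smoothness and the domination conditions.\<close>

definition LB1_support ::
  "'x measure \<Rightarrow> (real^'p::finite) set \<Rightarrow> (real^'p \<Rightarrow> 'x \<Rightarrow> real) \<Rightarrow> ('x \<Rightarrow> real) \<Rightarrow> bool" where
  "LB1_support \<mu> \<Theta> f h \<longleftrightarrow> (\<forall>\<theta>\<in>\<Theta>. dens_support \<mu> (f \<theta>) = dens_support \<mu> h)"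

definition LB2_smooth ::
  "'x measure \<Rightarrow> (real^'p::finite) set \<Rightarrow> (real^'p \<Rightarrow> 'x \<Rightarrow> real) \<Rightarrow> ('x \<Rightarrow> real) \<Rightarrow> real^'p \<Rightarrow> (real^'p) set \<Rightarrow> bool" where
  "LB2_smooth \<mu> \<Theta> f h \<theta> W \<longleftrightarrow>
     open W \<and> W \<subseteq> \<Theta> \<and> \<theta> \<in> W \<and>
     (AE x in \<mu>. x \<in> dens_support \<mu> h \<longrightarrow>
        times_differentiable_on 3 (\<lambda>\<theta>'. f \<theta>' x) W \<and>
        (\<forall>i j k. continuous_on W (pds [i, j, k] (\<lambda>\<theta>'. f \<theta>' x))))"

definition diff_under_integral ::
  "nat \<Rightarrow> 'x measure \<Rightarrow> (real^'p::finite \<Rightarrow> 'x \<Rightarrow> real) \<Rightarrow> (real^'p) set \<Rightarrow> bool" where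
  "diff_under_integral k \<mu> \<phi> W \<longleftrightarrow>
     times_differentiable_on k (\<lambda>\<theta>. \<integral>x. \<phi> \<theta> x \<partial>\<mu>) W \<and>
     (\<forall>is. length is \<le> k \<longrightarrow> (\<forall>\<theta>\<in>W.
        integrable \<mu> (\<lambda>x. pds is (\<lambda>\<theta>'. \<phi> \<theta>' x) \<theta>) \<and>
        pds is (\<lambda>\<theta>'. \<integral>x. \<phi> \<theta>' x \<partial>\<mu>) \<theta> = (\<integral>x. pds is (\<lambda>\<theta>'. \<phi> \<theta>' x) \<theta> \<partial>\<mu>)))"

definition LB3_integrals ::
  "'x measure \<Rightarrow> (real^'p::finite \<Rightarrow> 'x \<Rightarrow> real) \<Rightarrow> real \<Rightarrow> ('x \<Rightarrow> real) \<Rightarrow> (real^'p) set \<Rightarrow> bool" where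
  "LB3_integrals \<mu> f \<beta> h W \<longleftrightarrow>
     diff_under_integral 3 \<mu> (\<lambda>\<theta> x. f \<theta> x powr (1 + \<beta>)) W \<and>
     diff_under_integral 3 \<mu> (\<lambda>\<theta> x. f \<theta> x powr \<beta> * h x) W"

definition positive_definite :: "real^'p::finite^'p \<Rightarrow> bool" where
  "positive_definite A \<longleftrightarrow> transpose A = A \<and> (\<forall>v. v \<noteq> 0 \<longrightarrow> 0 < v \<bullet> (A *v v))"

definition LB4_pos_def ::
  "'x measure \<Rightarrow> (real^'p::finite \<Rightarrow> 'x \<Rightarrow> real) \<Rightarrow> real \<Rightarrow> ('x \<Rightarrow> real) \<Rightarrow> real^'p \<Rightarrow> bool" where
  "LB4_pos_def \<mu> f \<beta> h \<theta> \<longleftrightarrow>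
     positive_definite (J_matrix \<mu> f \<beta> \<theta> +
       (\<chi> i j. \<integral>x. (info f \<theta> x $ i $ j - \<beta> * (score f \<theta> x $ i * score f \<theta> x $ j)) *
                     (h x - f \<theta> x) * f \<theta> x powr \<beta> \<partial>\<mu>))"

definition LB5_dominated ::
  "'x measure \<Rightarrow> (real^'p::finite \<Rightarrow> 'x \<Rightarrow> real) \<Rightarrow> real \<Rightarrow> ('x \<Rightarrow> real) \<Rightarrow> (real^'p) set \<Rightarrow> bool" where
  "LB5_dominated \<mu> f \<beta> h W \<longleftrightarrow>
     (\<exists>B :: 'p \<Rightarrow> 'p \<Rightarrow> 'p \<Rightarrow> 'x \<Rightarrow> real. \<forall>j k l.
        (AE x in \<mu>. x \<in> dens_support \<mu> h \<longrightarrow>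
           (\<forall>\<theta>\<in>W. \<bar>pds [j, k, l] (\<lambda>\<theta>'. V \<mu> \<beta> f \<theta>' x) \<theta>\<bar> \<le> B j k l x)) \<and>
        integrable (density \<mu> (\<lambda>x. ennreal (h x))) (B j k l))"

definition LB_conditions ::
  "'x measure \<Rightarrow> (real^'p::finite) set \<Rightarrow> (real^'p \<Rightarrow> 'x \<Rightarrow> real) \<Rightarrow> real \<Rightarrow> ('x \<Rightarrow> real) \<Rightarrow> real^'p \<Rightarrow> bool" where
  "LB_conditions \<mu> \<Theta> f \<beta> h \<theta> \<longleftrightarrow>
     LB1_support \<mu> \<Theta> f h \<and> LB4_pos_def \<mu> f \<beta> h \<theta> \<and>
     (\<exists>W. LB2_smooth \<mu> \<Theta> f h \<theta> W \<and> LB3_integrals \<mu> f \<beta> h W \<and> LB5_dominated \<mu> f \<beta> h W)"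


section \<open>Convergence and normal laws\<close>

definition tendsto_in_probability ::
  "'w measure \<Rightarrow> (nat \<Rightarrow> 'w \<Rightarrow> 'a::metric_space) \<Rightarrow> 'a \<Rightarrow> bool" where
  "tendsto_in_probability M Z c \<longleftrightarrow>
     (\<forall>\<epsilon>>0. (\<lambda>n. measure M {\<omega> \<in> space M. \<epsilon> < dist (Z n \<omega>) c}) \<longlonglongrightarrow> 0)"

text \<open>The event need not be measurable, so it is only required to contain measurable events of
  probability tending to one.\<close>

definition with_prob_to_one :: "'w measure \<Rightarrow> (nat \<Rightarrow> 'w \<Rightarrow> bool) \<Rightarrow> bool" where
  "with_prob_to_one M P \<longleftrightarrow>
     (\<exists>A. (\<forall>n. A n \<in> sets M \<and> (\<forall>\<omega>\<in>A n. P n \<omega>)) \<and> (\<lambda>n. measure M (A n)) \<longlonglongrightarrow> 1)"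

text \<open>The library's \<open>weak_conv_m\<close> is restricted to measures on the real line; this is weak
  convergence of Borel probability measures on \<open>real^'q\<close>.\<close>

definition weak_conv_vec :: "(nat \<Rightarrow> (real^'q::finite) measure) \<Rightarrow> (real^'q) measure \<Rightarrow> bool" where
  "weak_conv_vec Ns N \<longleftrightarrow>
     (\<forall>\<phi> :: real^'q \<Rightarrow> real. continuous_on UNIV \<phi> \<longrightarrow> bounded (range \<phi>) \<longrightarrow>
        (\<lambda>n. \<integral>x. \<phi> x \<partial>Ns n) \<longlonglongrightarrow> (\<integral>x. \<phi> x \<partial>N))"

text \<open>Mean \<open>m\<close> and variance \<open>v \<ge> 0\<close>; for \<open>v = 0\<close> this is the point mass at \<open>m\<close>.\<close>

definition normal_law :: "real \<Rightarrow> real \<Rightarrow> real measure" where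
  "normal_law m v = distr (density lborel std_normal_density) borel (\<lambda>z. m + sqrt v * z)"

text \<open>The (possibly singular) normal law with mean \<open>m\<close> and covariance matrix \<open>S\<close>: every linear
  functional is univariate normal. By the Cramer-Wold device this determines the measure.\<close>

definition multivariate_normal ::
  "real^'q::finite \<Rightarrow> real^'q^'q \<Rightarrow> (real^'q) measure \<Rightarrow> bool" where
  "multivariate_normal m S N \<longleftrightarrow>
     prob_space N \<and> sets N = sets borel \<and> transpose S = S \<and>
     (\<forall>a. 0 \<le> a \<bullet> (S *v a) \<and> distr N borel (\<lambda>x. a \<bullet> x) = normal_law (a \<bullet> m) (a \<bullet> (S *v a)))"

definition stack :: "real^'p::finite \<Rightarrow> real^'q::finite \<Rightarrow> real^('p + 'q)" where
  "stack x y = (\<chi> k. case k of Inl i \<Rightarrow> x $ i | Inr j \<Rightarrow> y $ j)"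

definition block_matrix ::
  "real^'p::finite^'p \<Rightarrow> real^'q::finite^'p \<Rightarrow> real^'p^'q \<Rightarrow> real^'q^'q \<Rightarrow> real^('p + 'q)^('p + 'q)" where
  "block_matrix A B C D =
     (\<chi> k. case k of Inl i \<Rightarrow> stack (A $ i) (B $ i) | Inr j \<Rightarrow> stack (C $ j) (D $ j))"


section \<open>Estimators\<close>

definition dpd_objective ::
  "'x measure \<Rightarrow> real \<Rightarrow> (real^'p::finite \<Rightarrow> 'x \<Rightarrow> real) \<Rightarrow> (nat \<Rightarrow> 'w \<Rightarrow> 'x) \<Rightarrow> nat \<Rightarrow> 'w \<Rightarrow> real^'p \<Rightarrow> real" where
  "dpd_objective \<mu> \<beta> f X n \<omega> \<theta> = 1 / real n * (\<Sum>i<n. V \<mu> \<beta> f \<theta> (X i \<omega>))"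

text \<open>For \<open>\<beta> > 0\<close> the objective is \<open>+\<infinity>\<close> where \<open>f \<theta> powr (1 + \<beta>)\<close> is not integrable (the Bochner
  integral in \<open>V\<close> is then \<open>0\<close>), so such parameters cannot compete in a minimization. For
  \<open>\<beta> = 0\<close> every parameter of the model qualifies.\<close>

definition finite_objective :: "'x measure \<Rightarrow> real \<Rightarrow> (real^'p::finite \<Rightarrow> 'x \<Rightarrow> real) \<Rightarrow> real^'p \<Rightarrow> bool" where
  "finite_objective \<mu> \<beta> f \<theta> \<longleftrightarrow> integrable \<mu> (\<lambda>x. f \<theta> x powr (1 + \<beta>))"

text \<open>Both usual readings of the minimum density power divergence estimator are admitted: a minimizer
  of the objective over \<open>\<Theta>\<close>, or a root of the estimating equation (gradient of the objective equal
  to \<open>0\<close>), which need not be a global minimizer. Either need only exist with probability tending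
  to one. Consistency is not part of the definition.\<close>

definition mdpde ::
  "'w measure \<Rightarrow> 'x measure \<Rightarrow> (real^'p::finite) set \<Rightarrow> (real^'p \<Rightarrow> 'x \<Rightarrow> real) \<Rightarrow> real \<Rightarrow>
   (nat \<Rightarrow> 'w \<Rightarrow> 'x) \<Rightarrow> (nat \<Rightarrow> 'w \<Rightarrow> real^'p) \<Rightarrow> bool" where
  "mdpde M \<mu> \<Theta> f \<beta> X T \<longleftrightarrow>
     (\<forall>n. T n \<in> borel_measurable M) \<and> (\<forall>n. \<forall>\<omega>\<in>space M. T n \<omega> \<in> \<Theta>) \<and>
     with_prob_to_one M (\<lambda>n \<omega>.
       is_arg_min (dpd_objective \<mu> \<beta> f X n \<omega>) (\<lambda>\<theta>. \<theta> \<in> \<Theta> \<and> finite_objective \<mu> \<beta> f \<theta>) (T n \<omega>) \<or>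
       GDERIV (dpd_objective \<mu> \<beta> f X n \<omega>) (T n \<omega>) :> 0)"

definition restricted_mdpde ::
  "'w measure \<Rightarrow> 'x measure \<Rightarrow> (real^'p::finite) set \<Rightarrow> (real^'p \<Rightarrow> real^'r::finite) \<Rightarrow>
   (real^'p \<Rightarrow> 'x \<Rightarrow> real) \<Rightarrow> real \<Rightarrow> (nat \<Rightarrow> 'w \<Rightarrow> 'x) \<Rightarrow> (nat \<Rightarrow> 'w \<Rightarrow> real^'p) \<Rightarrow> bool" where
  "restricted_mdpde M \<mu> \<Theta> g f \<beta> X T \<longleftrightarrow>
     (\<forall>n. T n \<in> borel_measurable M) \<and> (\<forall>n. \<forall>\<omega>\<in>space M. T n \<omega> \<in> \<Theta>) \<and>
     with_prob_to_one M (\<lambda>n \<omega>.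
       is_arg_min (dpd_objective \<mu> \<beta> f X n \<omega>)
         (\<lambda>\<theta>. \<theta> \<in> \<Theta> \<and> g \<theta> = 0 \<and> finite_objective \<mu> \<beta> f \<theta>) (T n \<omega>))"

end

theory Submission
  imports Defs
begin

text \<open>This is the delta method. Differentiability of the divergence at \<open>(\<theta>, \<theta>s)\<close> together with
  consistency makes the scaled divergence difference equal to \<open>t \<bullet> Y\<^sub>1 + s \<bullet> Y\<^sub>2\<close>, where
  \<open>(Y\<^sub>1, Y\<^sub>2)\<close> is the scaled estimation error, up to a remainder that is eventually at most
  \<open>\<eta> \<parallel>Y\<parallel>\<close> outside an event of vanishing probability, for every \<open>\<eta> > 0\<close>.
  Weak convergence on the line only needs the Lipschitz test functions \<open>cts_step\<close>, for which the
  error caused by the remainder is bounded by the expectation of \<open>min 1 (\<eta> K \<parallel>Y\<parallel>)\<close>;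
  this is itself a continuous bounded function of \<open>Y\<close>, so no separate tightness argument is needed.\<close>

section \<open>The delta method for a general limit law\<close>

lemma abs_cts_step_diff_le:
  assumes "x < y"
  shows "\<bar>cts_step x y u - cts_step x y v\<bar> \<le> min 1 (\<bar>u - v\<bar> / (y - x))"
proof -
  have "\<bar>cts_step x y u - cts_step x y v\<bar> \<le> 1"
  proof -
    have "0 \<le> cts_step x y w \<and> cts_step x y w \<le> 1" for w
      using assms by (auto simp: cts_step_def)
    from this[of u] this[of v] show ?thesis by linarith
  qed
  moreover have "(y - x) * \<bar>cts_step x y u - cts_step x y v\<bar> \<le> \<bar>u - v\<bar>"
  proof -
    \<comment> \<open>Multiplying by \<open>y - x\<close> turns the step into \<open>y - w\<close>
      clamped to the interval from \<open>0\<close> to \<open>y - x\<close>. Clamping is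
      1-Lipschitz, and without the division this is linear arithmetic.\<close>
    have cts: "(y - x) * cts_step x y w = max 0 (min (y - x) (y - w))" for w
      using assms by (auto simp: cts_step_def max_def min_def)
    have "(y - x) * \<bar>cts_step x y u - cts_step x y v\<bar>
        = \<bar>(y - x) * cts_step x y u - (y - x) * cts_step x y v\<bar>"
      using assms by (simp add: abs_mult flip: right_diff_distrib)
    also have "\<dots> \<le> \<bar>u - v\<bar>"
      unfolding cts by linarith
    finally show ?thesis .
  qed
  ultimately show ?thesis
    using assms by (simp add: field_simps)
qed

lemma continuous_on_cts_step: "x < y \<Longrightarrow> continuous_on A (cts_step x y)"
  using continuous_on_subset cts_step_uniformly_continuous uniformly_continuous_imp_continuous
  by blast

text \<open>The truncation at \<open>1\<close> is what makes dominated convergence apply, so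
  \<open>N\<close> may lack moments. In \<open>delta_method\<close> this fixes the tolerance of the
  linear approximation from the limit law alone, before \<open>n\<close> is considered.\<close>

lemma integral_min_norm_tendsto_0:
  fixes N :: "'a::euclidean_space measure"
  assumes "prob_space N" and sets_N: "sets N = sets borel"
  shows "(\<lambda>k. \<integral>z. min 1 (norm z / real (Suc k)) \<partial>N) \<longlonglongrightarrow> 0"
proof -
  interpret N: prob_space N by fact
  note [measurable_cong] = sets_N
  have "(\<lambda>k. \<integral>z. min 1 (norm z / real (Suc k)) \<partial>N) \<longlonglongrightarrow> (\<integral>z. 0 \<partial>N)"
  proof (rule integral_dominated_convergence[where w = "\<lambda>_. 1"])
    have "(\<lambda>k. min 1 (norm z / real (Suc k))) \<longlonglongrightarrow> min 1 0" for z :: 'a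
      by (intro tendsto_intros LIMSEQ_Suc lim_const_over_n)
    then show "AE z in N. (\<lambda>k. min 1 (norm z / real (Suc k))) \<longlonglongrightarrow> 0"
      by simp
  qed auto
  then show ?thesis by simp
qed

text \<open>Consistency is a hypothesis of its own instead of a consequence of \<open>c n\<close>
  tending to infinity, which leaves the scaling arbitrary. Measurability of
  \<open>F (T n \<omega>)\<close> is also assumed, since \<open>F\<close> is controlled only through
  its derivative at \<open>a\<close>.\<close>

theorem delta_method:
  fixes T :: "nat \<Rightarrow> 'w \<Rightarrow> real^'q::finite" and F :: "real^'q \<Rightarrow> real" and c :: "nat \<Rightarrow> real"
  assumes "prob_space M" and "prob_space N" and sets_N: "sets N = sets borel"
    and T [measurable]: "\<And>n. T n \<in> borel_measurable M"
    and FT [measurable]: "\<And>n. (\<lambda>\<omega>. F (T n \<omega>)) \<in> borel_measurable M"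
    and consistent: "tendsto_in_probability M T a"
    and conv: "weak_conv_vec (\<lambda>n. distr M borel (\<lambda>\<omega>. c n *\<^sub>R (T n \<omega> - a))) N"
    and deriv: "(F has_derivative (\<lambda>h. d \<bullet> h)) (at a)"
  shows "weak_conv_m (\<lambda>n. distr M borel (\<lambda>\<omega>. c n * (F (T n \<omega>) - F a))) (distr N borel (\<lambda>z. d \<bullet> z))"
proof -
  interpret M: prob_space M by fact
  interpret N: prob_space N by fact
  note [measurable_cong] = sets_N
  define Y where "Y n \<omega> = c n *\<^sub>R (T n \<omega> - a)" for n \<omega>
  define Z where "Z n \<omega> = c n * (F (T n \<omega>) - F a)" for n \<omega>
  have Y [measurable]: "Y n \<in> borel_measurable M" for n
    unfolding Y_def[abs_def] by measurable
  have Z [measurable]: "Z n \<in> borel_measurable M" for n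
    unfolding Z_def[abs_def] by measurable
  \<comment> \<open>Weak convergence is restated on the sample space \<open>M\<close>, where
    \<open>Y n\<close> and \<open>Z n\<close> live together and can be compared pointwise.\<close>
  have expectation_conv: "(\<lambda>n. \<integral>\<omega>. \<phi> (Y n \<omega>) \<partial>M) \<longlonglongrightarrow> (\<integral>z. \<phi> z \<partial>N)"
    if \<phi>: "continuous_on UNIV \<phi>" "bounded (range \<phi>)" for \<phi> :: "real^'q \<Rightarrow> real"
  proof -
    have [measurable]: "\<phi> \<in> borel_measurable borel"
      using \<phi>(1) by (rule borel_measurable_continuous_onI)
    have "(\<integral>z. \<phi> z \<partial>distr M borel (\<lambda>\<omega>. c n *\<^sub>R (T n \<omega> - a))) = (\<integral>\<omega>. \<phi> (Y n \<omega>) \<partial>M)" for n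
      unfolding Y_def by (rule integral_distr) measurable
    moreover have "(\<lambda>n. \<integral>z. \<phi> z \<partial>distr M borel (\<lambda>\<omega>. c n *\<^sub>R (T n \<omega> - a))) \<longlonglongrightarrow> (\<integral>z. \<phi> z \<partial>N)"
      using conv \<phi> unfolding weak_conv_vec_def by blast
    ultimately show ?thesis by simp
  qed
  have "weak_conv_m (\<lambda>n. distr M borel (Z n)) (distr N borel (\<lambda>z. d \<bullet> z))"
  proof (rule integral_cts_step_conv_imp_weak_conv)
    show "real_distribution (distr M borel (Z n))" for n
      by (rule M.real_distribution_distr) measurable
    show "real_distribution (distr N borel (\<lambda>z. d \<bullet> z))"
      by (rule N.real_distribution_distr) measurable
  next
    fix x y :: real assume xy: "x < y"
    let ?\<phi> = "cts_step x y"
    have [measurable]: "?\<phi> \<in> borel_measurable borel"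
      using xy by (intro borel_measurable_continuous_onI continuous_on_cts_step)
    have \<phi>_bound: "\<bar>?\<phi> u\<bar> \<le> 1" for u
      using xy by (auto simp: cts_step_def)
    define \<Delta> where "\<Delta> n = (\<integral>\<omega>. ?\<phi> (Z n \<omega>) \<partial>M) - (\<integral>\<omega>. ?\<phi> (d \<bullet> Y n \<omega>) \<partial>M)" for n
    have "(\<lambda>n. \<integral>\<omega>. ?\<phi> (d \<bullet> Y n \<omega>) \<partial>M) \<longlonglongrightarrow> (\<integral>z. ?\<phi> (d \<bullet> z) \<partial>N)"
    proof (rule expectation_conv)
      show "continuous_on UNIV (\<lambda>z. ?\<phi> (d \<bullet> z))"
        by (rule continuous_on_compose2[OF continuous_on_cts_step[OF xy, of UNIV]])
           (auto intro!: continuous_intros)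
      show "bounded (range (\<lambda>z. ?\<phi> (d \<bullet> z)))"
        using \<phi>_bound by (auto simp: bounded_iff)
    qed
    moreover have "\<Delta> \<longlonglongrightarrow> 0"
    proof (rule LIMSEQ_I)
      fix \<epsilon> :: real assume "0 < \<epsilon>"
      then obtain k where k: "(\<integral>z. min 1 (norm z / real (Suc k)) \<partial>N) < \<epsilon> / 2"
        using order_tendstoD(2)[OF integral_min_norm_tendsto_0[OF \<open>prob_space N\<close> sets_N], of "\<epsilon> / 2"]
        by (auto simp: eventually_sequentially)
      define \<psi> :: "real^'q \<Rightarrow> real" where "\<psi> z = min 1 (norm z / real (Suc k))" for z
      \<comment> \<open>The factor \<open>y - x\<close> cancels the Lipschitz constant
        \<open>1 / (y - x)\<close> of the step, leaving exactly the quotient inside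
        \<open>\<psi>\<close>.\<close>
      define \<eta> where "\<eta> = (y - x) / real (Suc k)"
      have "0 < \<eta>" using xy by (simp add: \<eta>_def)
      have \<psi>_cont: "continuous_on UNIV \<psi>"
        unfolding \<psi>_def[abs_def] by (intro continuous_intros) simp
      have \<psi>_bound: "\<bar>\<psi> z\<bar> \<le> 1" for z
        by (auto simp: \<psi>_def min_def)
      have [measurable]: "\<psi> \<in> borel_measurable borel"
        using \<psi>_cont by (rule borel_measurable_continuous_onI)
      obtain \<delta> where "0 < \<delta>" and \<delta>:
        "\<And>z. norm (z - a) < \<delta> \<Longrightarrow> \<bar>F z - F a - d \<bullet> (z - a)\<bar> \<le> \<eta> * norm (z - a)"
        using deriv \<open>0 < \<eta>\<close> unfolding has_derivative_at_alt by (auto simp: real_norm_def)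
      \<comment> \<open>Off \<open>B n\<close> the distance is at most \<open>\<delta> / 2\<close>;
        halving supplies the strict inequality that the derivative estimate asks for.\<close>
      define B where "B n = {\<omega> \<in> space M. \<delta> / 2 < dist (T n \<omega>) a}" for n
      have [measurable]: "B n \<in> sets M" for n
        unfolding B_def by measurable
      have pointwise: "\<bar>?\<phi> (Z n \<omega>) - ?\<phi> (d \<bullet> Y n \<omega>)\<bar> \<le> \<psi> (Y n \<omega>) + indicator (B n) \<omega>"
        if "\<omega> \<in> space M" for n \<omega>
      \<comment> \<open>On \<open>B n\<close> the trivial bound \<open>1\<close> is paid for by the
        indicator. Off \<open>B n\<close> the derivative estimate, multiplied by
        \<open>\<bar>c n\<bar>\<close>, compares \<open>Z n\<close> with its linearization.\<close>
      proof (cases "\<omega> \<in> B n")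
        case True
        have "0 \<le> \<psi> (Y n \<omega>)" by (simp add: \<psi>_def)
        then show ?thesis
          using abs_cts_step_diff_le[OF xy, of "Z n \<omega>" "d \<bullet> Y n \<omega>"] True by simp
      next
        case False
        then have "norm (T n \<omega> - a) < \<delta>"
          using that \<open>0 < \<delta>\<close> by (simp add: B_def dist_norm)
        then have "\<bar>F (T n \<omega>) - F a - d \<bullet> (T n \<omega> - a)\<bar> \<le> \<eta> * norm (T n \<omega> - a)"
          by (rule \<delta>)
        then have "\<bar>c n\<bar> * \<bar>F (T n \<omega>) - F a - d \<bullet> (T n \<omega> - a)\<bar> \<le> \<bar>c n\<bar> * (\<eta> * norm (T n \<omega> - a))"
          by (intro mult_left_mono) auto
        then have "\<bar>Z n \<omega> - d \<bullet> Y n \<omega>\<bar> \<le> \<eta> * norm (Y n \<omega>)"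
          by (simp add: Z_def Y_def right_diff_distrib mult.left_commute flip: abs_mult)
        then have "\<bar>Z n \<omega> - d \<bullet> Y n \<omega>\<bar> / (y - x) \<le> norm (Y n \<omega>) / real (Suc k)"
          using xy by (simp add: \<eta>_def field_simps)
        then have "min 1 (\<bar>Z n \<omega> - d \<bullet> Y n \<omega>\<bar> / (y - x)) \<le> \<psi> (Y n \<omega>)"
          unfolding \<psi>_def by (rule min.mono[OF order_refl])
        then show ?thesis
          using abs_cts_step_diff_le[OF xy, of "Z n \<omega>" "d \<bullet> Y n \<omega>"] False
          by (simp del: min_le_iff_disj min.bounded_iff)
      qed
      have int: "integrable M (\<lambda>\<omega>. ?\<phi> (Z n \<omega>))" "integrable M (\<lambda>\<omega>. ?\<phi> (d \<bullet> Y n \<omega>))"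
          "integrable M (\<lambda>\<omega>. \<psi> (Y n \<omega>))" "integrable M (indicator (B n) :: _ \<Rightarrow> real)" for n
        by (rule M.integrable_const_bound[where B = 1]; use \<phi>_bound \<psi>_bound in \<open>auto simp: indicator_def\<close>)+
      have \<Delta>_le: "\<bar>\<Delta> n\<bar> \<le> (\<integral>\<omega>. \<psi> (Y n \<omega>) \<partial>M) + measure M (B n)" for n
      proof -
        have "\<bar>\<Delta> n\<bar> = \<bar>\<integral>\<omega>. ?\<phi> (Z n \<omega>) - ?\<phi> (d \<bullet> Y n \<omega>) \<partial>M\<bar>"
          using int by (simp add: \<Delta>_def)
        also have "\<dots> \<le> (\<integral>\<omega>. \<bar>?\<phi> (Z n \<omega>) - ?\<phi> (d \<bullet> Y n \<omega>)\<bar> \<partial>M)"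
          by (rule integral_abs_bound)
        also have "\<dots> \<le> (\<integral>\<omega>. \<psi> (Y n \<omega>) + indicator (B n) \<omega> \<partial>M)"
          using int pointwise by (intro integral_mono) auto
        also have "\<dots> = (\<integral>\<omega>. \<psi> (Y n \<omega>) \<partial>M) + measure M (B n)"
          using int by simp
        finally show ?thesis .
      qed
      have "(\<lambda>n. \<integral>\<omega>. \<psi> (Y n \<omega>) \<partial>M) \<longlonglongrightarrow> (\<integral>z. \<psi> z \<partial>N)"
        using \<psi>_cont \<psi>_bound by (intro expectation_conv) (auto simp: bounded_iff)
      moreover have "(\<lambda>n. measure M (B n)) \<longlonglongrightarrow> 0"
        using consistent half_gt_zero[OF \<open>0 < \<delta>\<close>] unfolding tendsto_in_probability_def B_def by blast
      ultimately have "(\<lambda>n. (\<integral>\<omega>. \<psi> (Y n \<omega>) \<partial>M) + measure M (B n)) \<longlonglongrightarrow> (\<integral>z. \<psi> z \<partial>N) + 0"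
        by (rule tendsto_add)
      moreover have "(\<integral>z. \<psi> z \<partial>N) + 0 < \<epsilon>"
        using k \<open>0 < \<epsilon>\<close> by (simp add: \<psi>_def)
      ultimately have "\<forall>\<^sub>F n in sequentially. (\<integral>\<omega>. \<psi> (Y n \<omega>) \<partial>M) + measure M (B n) < \<epsilon>"
        by (rule order_tendstoD(2))
      then show "\<exists>n0. \<forall>n\<ge>n0. norm (\<Delta> n - 0) < \<epsilon>"
        using \<Delta>_le by (auto simp: eventually_sequentially intro: order.strict_trans1)
    qed
    ultimately have "(\<lambda>n. \<Delta> n + (\<integral>\<omega>. ?\<phi> (d \<bullet> Y n \<omega>) \<partial>M)) \<longlonglongrightarrow> 0 + (\<integral>z. ?\<phi> (d \<bullet> z) \<partial>N)"
      by (intro tendsto_add)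
    then show "(\<lambda>n. integral\<^sup>L (distr M borel (Z n)) ?\<phi>) \<longlonglongrightarrow> integral\<^sup>L (distr N borel (\<lambda>z. d \<bullet> z)) ?\<phi>"
      by (simp add: \<Delta>_def integral_distr)
  qed
  then show ?thesis
    by (simp add: Z_def[abs_def])
qed

section \<open>Stacked vectors, block matrices and joint convergence in probability\<close>

lemma sum_UNIV_Plus:
  fixes h :: "'a::finite + 'b::finite \<Rightarrow> 'c::comm_monoid_add"
  shows "(\<Sum>k\<in>UNIV. h k) = (\<Sum>i\<in>UNIV. h (Inl i)) + (\<Sum>j\<in>UNIV. h (Inr j))"
  using sum.Plus[of UNIV UNIV h] by simp

lemma stack_nth [simp]: "stack x y $ Inl i = x $ i" "stack x y $ Inr j = y $ j"
  by (simp_all add: stack_def)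

lemma inner_stack [simp]: "stack a b \<bullet> stack x y = a \<bullet> x + b \<bullet> y"
  by (simp add: inner_vec_def sum_UNIV_Plus)

lemma stack_diff: "stack x y - stack a b = stack (x - a) (y - b)"
  by (simp add: vec_eq_iff stack_def split: sum.split)

lemma block_matrix_mult_stack:
  "block_matrix A B C D *v stack x y = stack (A *v x + B *v y) (C *v x + D *v y)"
  by (simp add: vec_eq_iff block_matrix_def stack_def matrix_vector_mult_def sum_UNIV_Plus
      split: sum.split)

lemma dist_stack_le:
  fixes x a :: "real^'p::finite" and y b :: "real^'q::finite"
  shows "dist (stack x y) (stack a b) \<le> dist x a + dist y b"
proof -
  have "norm (stack u v) = sqrt ((norm u)\<^sup>2 + (norm v)\<^sup>2)" for u :: "real^'p" and v :: "real^'q"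
    by (simp add: norm_eq_sqrt_inner)
  then show ?thesis
    by (simp add: dist_norm stack_diff sqrt_sum_squares_le_sum)
qed

lemma stack_measurable [measurable]:
  assumes [measurable]: "S \<in> borel_measurable M" "T \<in> borel_measurable M"
  shows "(\<lambda>\<omega>. stack (S \<omega>) (T \<omega>)) \<in> borel_measurable M"
proof -
  have "(\<lambda>\<omega>. stack (S \<omega>) (T \<omega>) $ k) \<in> borel_measurable M" for k
    by (cases k) (simp_all add: measurable_compose[OF _ borel_measurable_nth])
  then show ?thesis
    unfolding borel_measurable_euclidean_space[of "\<lambda>\<omega>. stack (S \<omega>) (T \<omega>)"]
    by (auto simp: Basis_vec_def inner_axis)
qed

text \<open>A stacked error above \<open>\<epsilon>\<close> forces one of the two errors above
  \<open>\<epsilon> / 2\<close>, by \<open>dist_stack_le\<close>; a union bound then gives joint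
  from marginal convergence.\<close>

lemma tendsto_in_probability_stack:
  fixes S :: "nat \<Rightarrow> 'w \<Rightarrow> real^'p::finite" and T :: "nat \<Rightarrow> 'w \<Rightarrow> real^'q::finite"
  assumes "prob_space M"
    and [measurable]: "\<And>n. S n \<in> borel_measurable M" "\<And>n. T n \<in> borel_measurable M"
    and "tendsto_in_probability M S a" "tendsto_in_probability M T b"
  shows "tendsto_in_probability M (\<lambda>n \<omega>. stack (S n \<omega>) (T n \<omega>)) (stack a b)"
  unfolding tendsto_in_probability_def
proof (intro allI impI)
  interpret prob_space M by fact
  fix \<epsilon> :: real assume "0 < \<epsilon>"
  let ?S = "\<lambda>n. {\<omega> \<in> space M. \<epsilon> / 2 < dist (S n \<omega>) a}"
  let ?T = "\<lambda>n. {\<omega> \<in> space M. \<epsilon> / 2 < dist (T n \<omega>) b}"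
  have "(\<lambda>n. prob (?S n)) \<longlonglongrightarrow> 0" "(\<lambda>n. prob (?T n)) \<longlonglongrightarrow> 0"
    using assms(4,5) half_gt_zero[OF \<open>0 < \<epsilon>\<close>] unfolding tendsto_in_probability_def by blast+
  then have lim: "(\<lambda>n. prob (?S n) + prob (?T n)) \<longlonglongrightarrow> 0"
    using tendsto_add by fastforce
  have le: "prob {\<omega> \<in> space M. \<epsilon> < dist (stack (S n \<omega>) (T n \<omega>)) (stack a b)} \<le> prob (?S n) + prob (?T n)"
    for n
  proof -
    have "{\<omega> \<in> space M. \<epsilon> < dist (stack (S n \<omega>) (T n \<omega>)) (stack a b)} \<subseteq> ?S n \<union> ?T n"
      using dist_stack_le order.strict_trans2 by fastforce
    then have "prob {\<omega> \<in> space M. \<epsilon> < dist (stack (S n \<omega>) (T n \<omega>)) (stack a b)} \<le> prob (?S n \<union> ?T n)"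
      by (intro finite_measure_mono) measurable
    also have "\<dots> \<le> prob (?S n) + prob (?T n)"
      by (intro measure_Un_le) measurable
    finally show ?thesis .
  qed
  show "(\<lambda>n. prob {\<omega> \<in> space M. \<epsilon> < dist (stack (S n \<omega>) (T n \<omega>)) (stack a b)}) \<longlonglongrightarrow> 0"
    by (rule tendsto_sandwich[OF _ _ tendsto_const lim]) (use le in \<open>auto simp del: le_divide_eq_numeral1 divide_less_eq_numeral1\<close>)
qed

section \<open>Coordinate gradients and Frechet derivatives\<close>

lemma grad_eq_of_has_derivative:
  fixes F :: "real^'p::finite \<Rightarrow> real"
  assumes "(F has_derivative F') (at x)"
  shows "F' h = grad F x \<bullet> h"
proof -
  interpret F': bounded_linear F'
    using assms by (rule has_derivative_bounded_linear)
  \<comment> \<open>\<open>pd\<close> uses the total function \<open>deriv\<close>, whose value is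
    informative only where a derivative exists; the chain rule along the coordinate line provides
    it.\<close>
  have "pd i F x = F' (axis i 1)" for i
  proof -
    have "((\<lambda>t. x + t *\<^sub>R axis i 1) has_derivative (\<lambda>t. t *\<^sub>R axis i 1)) (at (0::real))"
      by (auto intro!: derivative_eq_intros)
    then have "((\<lambda>t. F (x + t *\<^sub>R axis i 1)) has_derivative (\<lambda>t. F' (t *\<^sub>R axis i 1))) (at 0)"
      using has_derivative_compose[of "\<lambda>t. x + t *\<^sub>R axis i 1" _ 0 UNIV F F'] assms by simp
    then have "((\<lambda>t. F (x + t *\<^sub>R axis i 1)) has_field_derivative F' (axis i 1)) (at 0)"
      unfolding has_field_derivative_def
      by (rule has_derivative_eq_rhs) (simp add: F'.scaleR fun_eq_iff)
    then show ?thesis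
      unfolding pd_def by (rule DERIV_imp_deriv)
  qed
  moreover have "F' h = (\<Sum>i\<in>UNIV. h $ i * F' (axis i 1))"
    by (subst basis_expansion[of h, symmetric]) (simp add: F'.sum F'.scaleR scalar_mult_eq_scaleR)
  ultimately show ?thesis
    by (simp add: inner_vec_def grad_def mult.commute)
qed

text \<open>Moves differentiability from pairs to vectors indexed by a sum type, where
  \<open>delta_method\<close> operates. Freezing one argument identifies \<open>D'\<close> on each
  factor with a partial gradient, and \<open>D' (u, v)\<close> is the sum of
  \<open>D' (u, 0)\<close> and \<open>D' (0, v)\<close>.\<close>

lemma has_derivative_unstack:
  fixes D :: "real^'p::finite \<Rightarrow> real^'q::finite \<Rightarrow> real"
  assumes "(\<lambda>(x, y). D x y) differentiable (at (a, b))"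
  shows "((\<lambda>z. D (\<chi> i. z $ Inl i) (\<chi> j. z $ Inr j)) has_derivative
      (\<lambda>h. stack (grad (\<lambda>x. D x b) a) (grad (D a) b) \<bullet> h)) (at (stack a b))"
proof -
  obtain D' where D': "((\<lambda>(x, y). D x y) has_derivative D') (at (a, b))"
    using assms unfolding differentiable_def by blast
  interpret D': bounded_linear D'
    using D' by (rule has_derivative_bounded_linear)
  have "((\<lambda>x. D x b) has_derivative (\<lambda>u. D' (u, 0))) (at a)"
    using has_derivative_compose[of "\<lambda>x. (x, b)" "\<lambda>u. (u, 0)" a UNIV "\<lambda>(x, y). D x y" D'] D'
    by (simp add: has_derivative_Pair)
  then have D'_left: "D' (u, 0) = grad (\<lambda>x. D x b) a \<bullet> u" for u
    by (rule grad_eq_of_has_derivative)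
  have "((\<lambda>y. D a y) has_derivative (\<lambda>v. D' (0, v))) (at b)"
    using has_derivative_compose[of "\<lambda>y. (a, y)" "\<lambda>v. (0, v)" b UNIV "\<lambda>(x, y). D x y" D'] D'
    by (simp add: has_derivative_Pair)
  then have D'_right: "D' (0, v) = grad (D a) b \<bullet> v" for v
    by (rule grad_eq_of_has_derivative)
  let ?p = "\<lambda>z :: real^('p + 'q). ((\<chi> i. z $ Inl i) :: real^'p, (\<chi> j. z $ Inr j) :: real^'q)"
  have "linear ?p"
    by (rule linearI) (simp_all add: vec_eq_iff)
  then have p: "(?p has_derivative ?p) (at (stack a b))"
    by (intro bounded_linear_imp_has_derivative linear_conv_bounded_linear[THEN iffD1])
  have "?p (stack a b) = (a, b)"
    by (simp add: vec_eq_iff)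
  then have "((\<lambda>z. D (\<chi> i. z $ Inl i) (\<chi> j. z $ Inr j)) has_derivative (\<lambda>h. D' (?p h)))
      (at (stack a b))"
    using has_derivative_compose[OF p, of "\<lambda>(x, y). D x y" D'] D' by simp
  moreover have "D' (?p h) = stack (grad (\<lambda>x. D x b) a) (grad (D a) b) \<bullet> h" for h
  proof -
    have "D' (?p h) = D' (fst (?p h), 0) + D' (0, snd (?p h))"
      by (simp flip: D'.add)
    also have "\<dots> = stack (grad (\<lambda>x. D x b) a) (grad (D a) b) \<bullet> stack (fst (?p h)) (snd (?p h))"
      by (simp only: D'_left D'_right inner_stack)
    also have "stack (fst (?p h)) (snd (?p h)) = h"
      by (simp add: vec_eq_iff stack_def split: sum.split)
    finally show ?thesis .
  qed
  ultimately show ?thesis by simp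
qed

theorem theorem7:
  fixes \<mu> :: "'x measure"
    and \<Theta> :: "(real^'p::finite) set"
    and f :: "real^'p \<Rightarrow> 'x \<Rightarrow> real"
    and g :: "real^'p \<Rightarrow> real^'r::finite"
    and M :: "'w measure"
    and X :: "nat \<Rightarrow> 'w \<Rightarrow> 'x"
    and \<theta> \<theta>s :: "real^'p"
    and \<theta>_hat \<theta>_tilde :: "nat \<Rightarrow> 'w \<Rightarrow> real^'p"
    and A\<^sub>1\<^sub>2 \<Sigma> :: "real^'p^'p"
    and N :: "(real^('p + 'p)) measure"
    and \<beta> \<gamma> :: real
    and t s :: "real^'p"
  assumes "0 \<le> \<beta>" and "0 \<le> \<gamma>"
    and "parametric_model \<mu> \<Theta> f"
    and "regular_constraints \<Theta> g"
    \<comment> \<open>the true value does not satisfy the constraints, \<open>\<theta>s\<close> does\<close>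
    and "\<theta> \<in> \<Theta>" and "g \<theta> \<noteq> 0"
    and "\<theta>s \<in> \<Theta>" and "g \<theta>s = 0"
    and "LB_conditions \<mu> \<Theta> f \<beta> (f \<theta>) \<theta>"
    and "JK_exist \<mu> f \<beta> \<theta>"
    \<comment> \<open>i.i.d. sample from \<open>f \<theta>\<close>\<close>
    and "prob_space M"
    and "prob_space.indep_vars M (\<lambda>_. \<mu>) X UNIV"
    and "\<And>i. distributed M \<mu> (X i) (\<lambda>x. ennreal (f \<theta> x))"
    and "mdpde M \<mu> \<Theta> f \<beta> X \<theta>_hat"
    and "tendsto_in_probability M \<theta>_hat \<theta>"
    and "restricted_mdpde M \<mu> \<Theta> g f \<beta> X \<theta>_tilde"
    and "tendsto_in_probability M \<theta>_tilde \<theta>s"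
    and "multivariate_normal 0
           (block_matrix
             (matrix_inv (J_matrix \<mu> f \<beta> \<theta>) ** K_matrix \<mu> f \<beta> \<theta> ** matrix_inv (J_matrix \<mu> f \<beta> \<theta>)) A\<^sub>1\<^sub>2
             (transpose A\<^sub>1\<^sub>2) \<Sigma>) N"
    and "weak_conv_vec
           (\<lambda>n. distr M borel (\<lambda>\<omega>. sqrt (real n) *\<^sub>R stack (\<theta>_hat n \<omega> - \<theta>) (\<theta>_tilde n \<omega> - \<theta>s))) N"
    \<comment> \<open>the divergence is differentiable as a function of the pair of parameters, and its value at the
        estimators is a random variable\<close>
    and "(\<lambda>(\<theta>\<^sub>1, \<theta>\<^sub>2). dpd \<mu> \<gamma> (f \<theta>\<^sub>1) (f \<theta>\<^sub>2)) differentiable (at (\<theta>, \<theta>s))"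
    and "\<And>n. (\<lambda>\<omega>. dpd \<mu> \<gamma> (f (\<theta>_hat n \<omega>)) (f (\<theta>_tilde n \<omega>))) \<in> borel_measurable M"
    and "t = grad (\<lambda>\<theta>\<^sub>1. dpd \<mu> \<gamma> (f \<theta>\<^sub>1) (f \<theta>s)) \<theta>"
    and "s = grad (\<lambda>\<theta>\<^sub>2. dpd \<mu> \<gamma> (f \<theta>) (f \<theta>\<^sub>2)) \<theta>s"
  shows "weak_conv_m
           (\<lambda>n. distr M borel (\<lambda>\<omega>. sqrt (real n) *
              (dpd \<mu> \<gamma> (f (\<theta>_hat n \<omega>)) (f (\<theta>_tilde n \<omega>)) - dpd \<mu> \<gamma> (f \<theta>) (f \<theta>s))))
           (normal_law 0
             (t \<bullet> ((matrix_inv (J_matrix \<mu> f \<beta> \<theta>) ** K_matrix \<mu> f \<beta> \<theta> ** matrix_inv (J_matrix \<mu> f \<beta> \<theta>)) *v t)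
              + 2 * (t \<bullet> (A\<^sub>1\<^sub>2 *v s)) + s \<bullet> (\<Sigma> *v s)))"
proof -
  let ?D = "\<lambda>\<theta>\<^sub>1 \<theta>\<^sub>2. dpd \<mu> \<gamma> (f \<theta>\<^sub>1) (f \<theta>\<^sub>2)"
  let ?F = "\<lambda>z :: real^('p + 'p). ?D (\<chi> i. z $ Inl i) (\<chi> j. z $ Inr j)"
  let ?T = "\<lambda>n \<omega>. stack (\<theta>_hat n \<omega>) (\<theta>_tilde n \<omega>)"
  let ?A = "matrix_inv (J_matrix \<mu> f \<beta> \<theta>) ** K_matrix \<mu> f \<beta> \<theta> ** matrix_inv (J_matrix \<mu> f \<beta> \<theta>)"
  let ?S = "block_matrix ?A A\<^sub>1\<^sub>2 (transpose A\<^sub>1\<^sub>2) \<Sigma>"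
  let ?\<sigma>2 = "t \<bullet> (?A *v t) + 2 * (t \<bullet> (A\<^sub>1\<^sub>2 *v s)) + s \<bullet> (\<Sigma> *v s)"
  have F_stack: "?F (stack x y) = ?D x y" for x y
    by simp
  have [measurable]:
    "\<And>n. \<theta>_hat n \<in> borel_measurable M" "\<And>n. \<theta>_tilde n \<in> borel_measurable M"
    using assms(14,16) by (auto simp: mdpde_def restricted_mdpde_def)
  \<comment> \<open>The projection of \<open>N\<close> along \<open>stack t s\<close> is univariate
    normal by the very definition of \<open>multivariate_normal\<close>; variance \<open>0\<close>
    is included as a point mass.\<close>
  have N: "prob_space N" "sets N = sets borel"
    "distr N borel (\<lambda>z. stack t s \<bullet> z) = normal_law (stack t s \<bullet> 0) (stack t s \<bullet> (?S *v stack t s))"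
    using assms(18) by (auto simp: multivariate_normal_def)
  have "weak_conv_m (\<lambda>n. distr M borel (\<lambda>\<omega>. sqrt (real n) * (?F (?T n \<omega>) - ?F (stack \<theta> \<theta>s))))
      (distr N borel (\<lambda>z. stack t s \<bullet> z))"
  proof (rule delta_method)
    show "(\<lambda>\<omega>. ?F (?T n \<omega>)) \<in> borel_measurable M" for n
      unfolding F_stack by (rule assms(21))
    show "tendsto_in_probability M ?T (stack \<theta> \<theta>s)"
      using assms(11,15,17) by (intro tendsto_in_probability_stack) measurable
    show "weak_conv_vec (\<lambda>n. distr M borel (\<lambda>\<omega>. sqrt (real n) *\<^sub>R (?T n \<omega> - stack \<theta> \<theta>s))) N"
      unfolding stack_diff by (rule assms(19))
    show "(?F has_derivative (\<lambda>h. stack t s \<bullet> h)) (at (stack \<theta> \<theta>s))"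
      unfolding assms(22,23) by (rule has_derivative_unstack) (rule assms(20))
  qed (use assms(11) N in auto)
  \<comment> \<open>The two off-diagonal blocks are transposes of each other, so they contribute the
    same number; hence the factor \<open>2\<close>.\<close>
  moreover have "stack t s \<bullet> (?S *v stack t s) = ?\<sigma>2"
    by (simp add: block_matrix_mult_stack inner_add_right inner_commute[of s "t v* A\<^sub>1\<^sub>2"]
        dot_lmul_matrix)
  ultimately show ?thesis
    unfolding F_stack N(3) by simp
qed

end
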